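(* Let $p\in(0,1)$ be fixed. With high probability, $$ \mathrm{sat}\left(G\left(n,p\right),C_4\right)\leqslant \frac{3(1+(1-p)^3)}{2(1-(1-p)^3)}n(1+o(1)) $$ when $p>1-1/\sqrt[3]{7}$, and $$ \mathrm{sat}\left(G\left(n,p\right),C_4\right)\leqslant \left(\frac{s+1}{2}+s(1-p)^s+\frac{s(1-p)^{2s}}{1-(1-p)^s}\right)n(1+o(1)) $$ when $p\leqslant1-1/\sqrt[3]{7}$, where $s$ is the minimum positive integer such that $(2s^2+1)(1-p)^s < 1$.
   Context: $G(n,p)$ is the binomial random graph on vertex set $[n]$ in which each pair of vertices is adjacent independently with probability $p$. A property holds with high probability if its probability tends to $1$ as $n\to\infty$; $o(1)$ denotes a function of $n$ tending to $0$. $C_4$ is the cycle on $4$ vertices. For graphs $F,G$, a spanning subgraph $H\subseteq G$ is $F$-saturated in $G$ if $H$ contains no copy of $F$ but adding to $H$ any edge of $G$ not in $H$ creates a copy of $F$; $\mathrm{sat}(G,F)$ is the minimum number of edges of an $F$-saturated graph in $G$. *)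

theory Defs
  imports "HOL-Probability.Probability"
begin

text \<open>Simple graphs on the vertex set [n] = {0..<n} are represented by their edge
  sets, edges being 2-element subsets of vertices.\<close>

definition all_edges :: "nat \<Rightarrow> nat set set" where
  "all_edges n = {{i, j} | i j. i < j \<and> j < n}"

definition Gnp :: "nat \<Rightarrow> real \<Rightarrow> nat set set pmf" where
  "Gnp n p = map_pmf (\<lambda>f. {e \<in> all_edges n. f e})
              (Pi_pmf (all_edges n) False (\<lambda>_. bernoulli_pmf p))"

definition has_C4 :: "nat set set \<Rightarrow> bool" where
  "has_C4 H \<longleftrightarrow> (\<exists>a b c d. distinct [a, b, c, d] \<and>
      {a, b} \<in> H \<and> {b, c} \<in> H \<and> {c, d} \<in> H \<and> {d, a} \<in> H)"

definition C4_saturated_in :: "nat set set \<Rightarrow> nat set set \<Rightarrow> bool" where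
  "C4_saturated_in H G \<longleftrightarrow> H \<subseteq> G \<and> \<not> has_C4 H \<and> (\<forall>e \<in> G - H. has_C4 (insert e H))"

definition sat_C4 :: "nat set set \<Rightarrow> nat" where
  "sat_C4 G = (LEAST m. \<exists>H. C4_saturated_in H G \<and> card H = m)"

end

theory Submission
  imports Defs "HOL-Real_Asymp.Real_Asymp"
begin

text \<open>
  Choose hubs v 0, v 1, ..., v (m - 1) in G such that v 0 is adjacent to all the others, v 1 is
  adjacent to v 2, and every vertex is adjacent to some hub. The star at v 0, the edge between v 1
  and v 2, and one edge from each remaining vertex x to its first adjacent hub form a C4-free graph.
  However it is extended to a C4-saturated subgraph H of G, H stays sparse: two vertices with the
  same first hub have no further common neighbour, and vertices whose first hubs are adjacent in H
  are not adjacent themselves. Up to O(m^2), H therefore has at most n edges to first hubs, n/2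
  edges inside levels, and at most one edge for every vertex y and every level i with 0 < i that
  lies below the level of y, except that level 1 does not count when y is in level 2.

  In G(n,p) a triangle v 0, v 1, v 2 leaves about q^3 n vertices without a neighbour in it, where
  q = 1 - p, and some neighbour of v 0 is always adjacent to about a fraction p of the vertices not
  yet dominated. A greedy choice of O(n^(1/4)) hubs thus yields (3/2 + q^3 (1 + 1/p) + o(1)) n
  edges. This constant is strictly smaller than the one in the theorem in both ranges of p, so the
  error term of the theorem can be taken to be 0.
\<close>

section \<open>Graphs without 4-cycles\<close>

lemma finite_all_edges [simp]: "finite (all_edges n)"
  by (rule finite_subset[of _ "Pow {..<n}"]) (auto simp: all_edges_def)

lemma all_edges_iff: "{x, y} \<in> all_edges n \<longleftrightarrow> x < n \<and> y < n \<and> x \<noteq> y"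
proof
  assume "{x, y} \<in> all_edges n"
  then show "x < n \<and> y < n \<and> x \<noteq> y"
    by (auto simp: all_edges_def doubleton_eq_iff)
next
  assume "x < n \<and> y < n \<and> x \<noteq> y"
  then show "{x, y} \<in> all_edges n"
    unfolding all_edges_def mem_Collect_eq by (metis insert_commute linorder_neqE_nat)
qed

lemma common_nbrs_eq_if_C4_free:
  assumes "H \<subseteq> all_edges n" "\<not> has_C4 H"
    and "{a, b} \<in> H" "{b, c} \<in> H" "{c, d} \<in> H" "{d, a} \<in> H" "a \<noteq> c"
  shows "b = d"
proof -
  have "x \<noteq> y" if "{x, y} \<in> H" for x y
    using that assms(1) all_edges_iff by blast
  then have "\<not> distinct [a, b, c, d]" "a \<noteq> b" "b \<noteq> c" "c \<noteq> d" "d \<noteq> a"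
    using assms(2-6) unfolding has_C4_def by blast+
  with \<open>a \<noteq> c\<close> show ?thesis by auto
qed

lemma ex_C4_saturated_extension:
  assumes "finite G" "F \<subseteq> G" "\<not> has_C4 F"
  shows "\<exists>H. F \<subseteq> H \<and> C4_saturated_in H G"
proof -
  define \<F> where "\<F> = {H. F \<subseteq> H \<and> H \<subseteq> G \<and> \<not> has_C4 H}"
  have "finite \<F>" by (rule finite_subset[of _ "Pow G"]) (use assms in \<open>auto simp: \<F>_def\<close>)
  moreover have "F \<in> \<F>" using assms by (simp add: \<F>_def)
  ultimately have "\<exists>H\<in>\<F>. \<forall>H'\<in>\<F>. H \<subseteq> H' \<longrightarrow> H = H'"
    by (intro finite_has_maximal) auto
  then obtain H where "H \<in> \<F>" and max: "\<And>H'. H' \<in> \<F> \<Longrightarrow> H \<subseteq> H' \<Longrightarrow> H = H'" by blast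
  have "has_C4 (insert e H)" if "e \<in> G - H" for e
    using max[of "insert e H"] \<open>H \<in> \<F>\<close> that by (auto simp: \<F>_def)
  with \<open>H \<in> \<F>\<close> show ?thesis unfolding \<F>_def C4_saturated_in_def by blast
qed

lemma sat_C4_le_if_C4_free_extensions_le:
  assumes "finite G" "F \<subseteq> G" "\<not> has_C4 F"
    and "\<And>H. F \<subseteq> H \<Longrightarrow> H \<subseteq> G \<Longrightarrow> \<not> has_C4 H \<Longrightarrow> card H \<le> k"
  shows "sat_C4 G \<le> k"
proof -
  obtain H where H: "F \<subseteq> H" "C4_saturated_in H G"
    using ex_C4_saturated_extension[OF assms(1-3)] by blast
  then have "sat_C4 G \<le> card H"
    unfolding sat_C4_def by (intro Least_le) blast
  also have "\<dots> \<le> k"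
    using H assms(4) by (simp add: C4_saturated_in_def)
  finally show ?thesis .
qed

section \<open>C4-free extensions of a dominating star\<close>

definition common_nonnbrs :: "nat \<Rightarrow> nat set set \<Rightarrow> nat set \<Rightarrow> nat set" where
  "common_nonnbrs n G T = {x \<in> {..<n}. \<forall>t\<in>T. {x, t} \<notin> G}"

lemma finite_common_nonnbrs [simp]: "finite (common_nonnbrs n G T)"
  by (simp add: common_nonnbrs_def)

definition edges_of :: "(nat \<times> nat) set \<Rightarrow> nat set set" where
  "edges_of R = (\<lambda>(x, y). {x, y}) ` R"

lemma edges_ofI: "(x, y) \<in> R \<or> (y, x) \<in> R \<Longrightarrow> {x, y} \<in> edges_of R"
  by (force simp: edges_of_def doubleton_eq_iff)

lemma card_edges_of_le: "finite R \<Longrightarrow> card (edges_of R) \<le> card R"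
  unfolding edges_of_def by (rule card_image_le)

lemma two_card_le_if_pairwise_disjnt:
  assumes "M \<subseteq> all_edges n" "pairwise disjnt M"
  shows "2 * card M \<le> n"
proof -
  have "card e = 2 \<and> e \<subseteq> {..<n}" if "e \<in> M" for e
    using that assms(1) by (auto simp: all_edges_def)
  then have union: "\<Union>M \<subseteq> {..<n}" "sum card M = 2 * card M" "\<And>e. e \<in> M \<Longrightarrow> finite e"
    by (auto intro: finite_subset)
  then have "2 * card M = card (\<Union>M)"
    using assms(2) by (simp add: card_Union_disjoint)
  also have "\<dots> \<le> n"
    using card_mono[OF _ union(1)] by simp
  finally show ?thesis .
qed

locale hub_system =
  fixes n :: nat and G :: "nat set set" and m :: nat and v :: "nat \<Rightarrow> nat"
  assumes graph: "G \<subseteq> all_edges n"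
    and m_ge_3: "3 \<le> m"
    and star: "\<And>i. 0 < i \<Longrightarrow> i < m \<Longrightarrow> {v 0, v i} \<in> G"
    and triangle: "{v 1, v 2} \<in> G"
    and dominating: "common_nonnbrs n G (v ` {..<m}) = {}"
begin

definition hubs :: "nat set" where "hubs = v ` {..<m}"
definition nonhubs :: "nat set" where "nonhubs = {..<n} - hubs"
definition level :: "nat \<Rightarrow> nat" where "level x = (LEAST i. {x, v i} \<in> G)"
definition anchor :: "nat \<Rightarrow> nat" where "anchor x = v (level x)"
definition hub_edges :: "nat set set" where
  "hub_edges = insert {v 1, v 2} ((\<lambda>i. {v 0, v i}) ` {0<..<m})"
definition skeleton :: "nat set set" where
  "skeleton = hub_edges \<union> (\<lambda>x. {x, anchor x}) ` nonhubs"

lemma finite_nonhubs [simp]: "finite nonhubs" by (simp add: nonhubs_def)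
lemma finite_hubs [simp]: "finite hubs" by (simp add: hubs_def)

lemma card_hubs: "card hubs \<le> m"
  unfolding hubs_def using card_image_le[of "{..<m}" v] by simp

lemma
  assumes "x \<in> nonhubs"
  shows level_less: "level x < m"
    and anchor_adjacent: "{x, anchor x} \<in> G"
    and anchor_in_hubs: "anchor x \<in> hubs"
proof -
  have "x < n" using assms by (simp add: nonhubs_def)
  then obtain i where i: "i < m" "{x, v i} \<in> G"
    using dominating by (auto simp: common_nonnbrs_def)
  show "{x, anchor x} \<in> G" unfolding anchor_def level_def by (rule LeastI) (rule i)
  have "level x \<le> i" unfolding level_def by (rule Least_le) (rule i)
  then show "level x < m" using i by simp
  then show "anchor x \<in> hubs" by (simp add: hubs_def anchor_def)
qed

lemma anchor_neq_nonhub: "x \<in> nonhubs \<Longrightarrow> y \<in> nonhubs \<Longrightarrow> anchor x \<noteq> y"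
  using anchor_in_hubs by (auto simp: nonhubs_def)

lemma nonhub_in_common_nonnbrs:
  assumes "x \<in> nonhubs" "j \<le> level x"
  shows "x \<in> common_nonnbrs n G (v ` {..<j})"
proof -
  have "{x, v i} \<notin> G" if "i < j" for i
    using that assms(2) not_less_Least[of i "\<lambda>i. {x, v i} \<in> G"] by (simp add: level_def)
  then show ?thesis using assms(1) by (auto simp: common_nonnbrs_def nonhubs_def)
qed

lemma skeleton_subset: "skeleton \<subseteq> G"
  using star triangle anchor_adjacent by (auto simp: skeleton_def hub_edges_def)

lemma nbr_of_nonhub_in_skeleton:
  assumes "{x, y} \<in> skeleton" "x \<notin> hubs"
  shows "y = anchor x"
proof -
  have "v i \<in> hubs" if "i < m" for i using that by (simp add: hubs_def)
  then have "{x, y} \<notin> hub_edges"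
    using assms(2) m_ge_3 by (auto simp: hub_edges_def doubleton_eq_iff)
  then show ?thesis
    using assms anchor_in_hubs by (auto simp: skeleton_def doubleton_eq_iff)
qed

lemma skeleton_edge_between_hubs:
  assumes "{x, y} \<in> skeleton" "x \<in> hubs" "y \<in> hubs"
  shows "{x, y} = {v 1, v 2} \<or> v 0 \<in> {x, y}"
proof -
  have "{x, y} \<noteq> {z, anchor z}" if "z \<in> nonhubs" for z
    using that assms(2,3) by (auto simp: doubleton_eq_iff nonhubs_def)
  then show ?thesis
    using assms(1) unfolding skeleton_def hub_edges_def by blast
qed

lemma skeleton_not_C4: "\<not> has_C4 skeleton"
proof
  assume "has_C4 skeleton"
  then obtain a b c d where dist: "distinct [a, b, c, d]"
    and edges: "{a, b} \<in> skeleton" "{b, c} \<in> skeleton" "{c, d} \<in> skeleton" "{d, a} \<in> skeleton"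
    by (auto simp: has_C4_def)
  have "x \<in> hubs" if "{y, x} \<in> skeleton" "{x, z} \<in> skeleton" "y \<noteq> z" for x y z
    using that nbr_of_nonhub_in_skeleton by (metis insert_commute)
  then have hubs: "a \<in> hubs" "b \<in> hubs" "c \<in> hubs" "d \<in> hubs"
    using edges dist by auto
  \<comment> \<open>Of two opposite edges one avoids \<open>v 0\<close>; adjacent edges cannot both be \<open>{v 1, v 2}\<close>.\<close>
  have "{a, b} = {v 1, v 2} \<or> {c, d} = {v 1, v 2}"
    using skeleton_edge_between_hubs[OF edges(1)] skeleton_edge_between_hubs[OF edges(3)] hubs dist
    by auto
  moreover have "{b, c} = {v 1, v 2} \<or> {d, a} = {v 1, v 2}"
    using skeleton_edge_between_hubs[OF edges(2)] skeleton_edge_between_hubs[OF edges(4)] hubs dist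
    by auto
  ultimately show False using dist by (auto simp: doubleton_eq_iff)
qed

end

locale C4_free_hub_extension = hub_system +
  fixes H :: "nat set set"
  assumes skeleton_le: "skeleton \<subseteq> H" and H_subset: "H \<subseteq> G" and C4_free: "\<not> has_C4 H"
begin

lemma H_graph: "H \<subseteq> all_edges n"
  using H_subset graph by blast

lemma anchor_edge: "x \<in> nonhubs \<Longrightarrow> {x, anchor x} \<in> H" "x \<in> nonhubs \<Longrightarrow> {anchor x, x} \<in> H"
  using skeleton_le by (auto simp: skeleton_def insert_commute)

lemma nbrs_eq_if_level_eq:
  assumes "x \<in> nonhubs" "y \<in> nonhubs" "level x = level y" "z \<noteq> anchor x" "{z, x} \<in> H" "{z, y} \<in> H"
  shows "x = y"
proof (rule common_nbrs_eq_if_C4_free[OF H_graph C4_free])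
  show "{anchor x, y} \<in> H" using anchor_edge(2)[of y] assms by (simp add: anchor_def)
  show "{y, z} \<in> H" using assms(6) by (simp add: insert_commute)
qed (use assms anchor_edge in auto)

lemma anchors_not_adjacent:
  assumes "x \<in> nonhubs" "y \<in> nonhubs" "{x, y} \<in> H"
  shows "{anchor x, anchor y} \<notin> H"
proof
  assume "{anchor x, anchor y} \<in> H"
  moreover have "{y, x} \<in> H" using assms(3) by (simp add: insert_commute)
  moreover have "x \<noteq> anchor y" using assms anchor_neq_nonhub by metis
  ultimately have "anchor x = y"
    using assms anchor_edge common_nbrs_eq_if_C4_free[OF H_graph C4_free] by blast
  then show False using assms anchor_neq_nonhub by blast
qed

definition stray :: "(nat \<times> nat) set" where
  "stray = {(h, x). h \<in> hubs \<and> x \<in> nonhubs \<and> h \<noteq> anchor x \<and> {h, x} \<in> H}"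
definition lateral :: "(nat \<times> nat) set" where
  "lateral = {(x, y). x \<in> nonhubs \<and> y \<in> nonhubs \<and> level x = level y \<and> {x, y} \<in> H}"
definition ascending :: "(nat \<times> nat) set" where
  "ascending = {(x, y). x \<in> nonhubs \<and> y \<in> nonhubs \<and> level x < level y \<and> {x, y} \<in> H}"

lemma card_stray: "card stray \<le> m * m"
proof -
  have "inj_on (\<lambda>(h, x). (h, level x)) stray"
    using nbrs_eq_if_level_eq by (auto simp: inj_on_def stray_def)
  moreover have "(\<lambda>(h, x). (h, level x)) ` stray \<subseteq> hubs \<times> {..<m}"
    by (auto simp: stray_def level_less)
  ultimately have "card stray \<le> card (hubs \<times> {..<m})"
    by (intro card_inj_on_le) auto
  also have "\<dots> \<le> m * m" using card_hubs by simp
  finally show ?thesis .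
qed

lemma card_lateral: "2 * card (edges_of lateral) \<le> n"
proof (rule two_card_le_if_pairwise_disjnt)
  show "edges_of lateral \<subseteq> all_edges n"
    using H_graph by (auto simp: edges_of_def lateral_def)
  have unique: "y = z" if "(x, y) \<in> lateral" "(x, z) \<in> lateral" for x y z
    using that nbrs_eq_if_level_eq[of y z x] anchor_neq_nonhub by (auto simp: lateral_def)
  have other_end: "\<exists>y. (x, y) \<in> lateral \<and> e = {x, y}" if "e \<in> edges_of lateral" "x \<in> e" for x e
    using that by (auto simp: edges_of_def lateral_def insert_commute)
  show "pairwise disjnt (edges_of lateral)"
    unfolding pairwise_def disjnt_iff using other_end unique by metis
qed

\<comment> \<open>The adjacency of \<open>v 1\<close> and \<open>v 2\<close> rules out edges between levels 1 and 2, hence the 3.\<close>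
lemma ascending_levels:
  assumes "(x, y) \<in> ascending"
  shows "0 < level x" "max 3 (Suc (level x)) \<le> level y"
proof -
  have xy: "x \<in> nonhubs" "y \<in> nonhubs" "level x < level y" "{x, y} \<in> H"
    using assms by (auto simp: ascending_def)
  have "hub_edges \<subseteq> H" using skeleton_le by (simp add: skeleton_def)
  then have "{v 0, anchor y} \<in> H" "{v 1, v 2} \<in> H"
    using xy level_less[of y] by (auto simp: hub_edges_def anchor_def)
  then have "level x \<noteq> 0" "\<not> (level x = 1 \<and> level y = 2)"
    using anchors_not_adjacent[OF xy(1,2,4)] by (metis anchor_def)+
  with xy(3) show "0 < level x" "max 3 (Suc (level x)) \<le> level y" by auto
qed

lemma card_ascending:
  "card ascending \<le> (\<Sum>i=1..<m. card (common_nonnbrs n G (v ` {..<max 3 (Suc i)})))"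
proof -
  let ?\<Sigma> = "SIGMA i:{1..<m}. common_nonnbrs n G (v ` {..<max 3 (Suc i)})"
  have "x = x'" if "(x, y) \<in> ascending" "(x', y) \<in> ascending" "level x = level x'" for x x' y
    using that nbrs_eq_if_level_eq[of x x' y] anchor_neq_nonhub
    by (auto simp: ascending_def insert_commute)
  then have "inj_on (\<lambda>(x, y). (level x, y)) ascending"
    by (auto simp: inj_on_def)
  moreover have "(\<lambda>(x, y). (level x, y)) ` ascending \<subseteq> ?\<Sigma>"
  proof clarify
    fix x y assume asc: "(x, y) \<in> ascending"
    then have "level x < m" by (simp add: ascending_def level_less)
    moreover have "y \<in> common_nonnbrs n G (v ` {..<max 3 (Suc (level x))})"
      using asc ascending_levels(2)[OF asc]
      by (intro nonhub_in_common_nonnbrs) (auto simp: ascending_def)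
    ultimately show "level x \<in> {1..<m} \<and> y \<in> common_nonnbrs n G (v ` {..<max 3 (Suc (level x))})"
      using ascending_levels(1)[OF asc] by simp
  qed
  ultimately have "card ascending \<le> card ?\<Sigma>"
    by (rule card_inj_on_le) simp
  then show ?thesis by simp
qed

lemma H_subset_edge_classes:
  "H \<subseteq> edges_of (hubs \<times> hubs) \<union> (\<lambda>x. {x, anchor x}) ` nonhubs \<union> edges_of stray
    \<union> edges_of lateral \<union> edges_of ascending" (is "_ \<subseteq> ?R")
proof
  fix e assume "e \<in> H"
  then obtain x y where e: "e = {x, y}" "x < n" "y < n"
    using H_graph by (auto simp: all_edges_def)
  have mixed: "{h, z} \<in> ?R" if "h \<in> hubs" "z \<in> nonhubs" "{h, z} \<in> H" for h z
  proof (cases "h = anchor z")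
    case True
    then have "{h, z} = {z, anchor z}" by (simp add: insert_commute)
    then show ?thesis using that by blast
  next
    case False
    then have "(h, z) \<in> stray" using that by (simp add: stray_def)
    then show ?thesis using edges_ofI by blast
  qed
  consider "x \<in> hubs" "y \<in> hubs" | "x \<in> hubs" "y \<in> nonhubs" | "x \<in> nonhubs" "y \<in> hubs"
    | "x \<in> nonhubs" "y \<in> nonhubs"
    using e by (auto simp: nonhubs_def)
  then show "e \<in> ?R"
  proof cases
    case 1
    then show ?thesis unfolding e by (auto intro: edges_ofI)
  next
    case 2
    then show ?thesis using mixed \<open>e \<in> H\<close> e by simp
  next
    case 3
    then show ?thesis using mixed[of y x] \<open>e \<in> H\<close> e by (simp add: insert_commute)
  next
    case 4
    then have "(x, y) \<in> lateral \<or> (x, y) \<in> ascending \<or> (y, x) \<in> ascending"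
      using \<open>e \<in> H\<close> e by (auto simp: lateral_def ascending_def insert_commute)
    then show ?thesis unfolding e using edges_ofI by blast
  qed
qed

lemma card_H_le:
  "2 * card H \<le> 3 * n + 4 * m\<^sup>2
     + 2 * (\<Sum>i=1..<m. card (common_nonnbrs n G (v ` {..<max 3 (Suc i)})))"
proof -
  have fin: "finite stray" "finite lateral" "finite ascending"
    by (rule finite_subset[of _ "(nonhubs \<union> hubs) \<times> nonhubs"];
        force simp: stray_def lateral_def ascending_def)+
  have "card H \<le> card (edges_of (hubs \<times> hubs) \<union> (\<lambda>x. {x, anchor x}) ` nonhubs \<union> edges_of stray
    \<union> edges_of lateral \<union> edges_of ascending)"
    using fin by (intro card_mono H_subset_edge_classes) (auto simp: edges_of_def)
  also have "\<dots> \<le> card (edges_of (hubs \<times> hubs)) + card ((\<lambda>x. {x, anchor x}) ` nonhubs)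
      + card (edges_of stray) + card (edges_of lateral) + card (edges_of ascending)"
    by (intro order_trans[OF card_Un_le] add_mono order_refl)
  also have "\<dots> \<le> card (hubs \<times> hubs) + card nonhubs + card stray + card (edges_of lateral)
      + card ascending"
    using fin by (intro add_mono card_edges_of_le card_image_le order_refl) auto
  finally have "card H \<le> \<dots>" .
  moreover have "card (hubs \<times> hubs) \<le> m * m" using card_hubs by (simp add: mult_mono)
  moreover have "card nonhubs \<le> n"
    using card_mono[of "{..<n}" nonhubs] by (auto simp: nonhubs_def)
  ultimately show ?thesis
    using card_stray card_lateral card_ascending by (simp add: power2_eq_square)
qed

end

theorem (in hub_system) sat_C4_le:
  "real (sat_C4 G) \<le> 3 / 2 * real n + 2 * (real m)\<^sup>2
     + (\<Sum>i=1..<m. real (card (common_nonnbrs n G (v ` {..<max 3 (Suc i)}))))"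
proof -
  define S where "S = (\<Sum>i=1..<m. card (common_nonnbrs n G (v ` {..<max 3 (Suc i)})))"
  have "sat_C4 G \<le> (3 * n + 4 * m\<^sup>2 + 2 * S) div 2"
  proof (rule sat_C4_le_if_C4_free_extensions_le[OF _ skeleton_subset skeleton_not_C4])
    show "finite G" using graph finite_all_edges by (rule finite_subset)
    fix H assume "skeleton \<subseteq> H" "H \<subseteq> G" "\<not> has_C4 H"
    then interpret C4_free_hub_extension n G m v H by unfold_locales
    show "card H \<le> (3 * n + 4 * m\<^sup>2 + 2 * S) div 2"
      using card_H_le unfolding S_def by linarith
  qed
  then have "2 * sat_C4 G \<le> 3 * n + 4 * m\<^sup>2 + 2 * S" by linarith
  then have "real (2 * sat_C4 G) \<le> real (3 * n + 4 * m\<^sup>2 + 2 * S)" by (rule of_nat_mono)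
  then show ?thesis unfolding S_def by simp
qed

section \<open>Greedy domination in quasirandom graphs\<close>

definition quasirandom :: "nat \<Rightarrow> real \<Rightarrow> nat \<Rightarrow> real \<Rightarrow> nat set set \<Rightarrow> bool" where
  "quasirandom n p k \<delta> G \<longleftrightarrow> G \<subseteq> all_edges n \<and>
     (\<forall>T \<subseteq> {..<n}. card T \<le> k \<longrightarrow>
        \<bar>real (card (common_nonnbrs n G T)) - (1 - p) ^ card T * real n\<bar> \<le> \<delta> * real n)"

lemma quasirandom_bounds:
  assumes "quasirandom n p k \<delta> G" "T \<subseteq> {..<n}" "card T \<le> k"
  shows "real (card (common_nonnbrs n G T)) \<le> ((1 - p) ^ card T + \<delta>) * real n"
    and "((1 - p) ^ card T - \<delta>) * real n \<le> real (card (common_nonnbrs n G T))"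
proof -
  have "\<bar>real (card (common_nonnbrs n G T)) - (1 - p) ^ card T * real n\<bar> \<le> \<delta> * real n"
    using assms by (simp add: quasirandom_def)
  then show "real (card (common_nonnbrs n G T)) \<le> ((1 - p) ^ card T + \<delta>) * real n"
    and "((1 - p) ^ card T - \<delta>) * real n \<le> real (card (common_nonnbrs n G T))"
    by (simp_all add: algebra_simps)
qed

definition nbrs :: "nat \<Rightarrow> nat set set \<Rightarrow> nat \<Rightarrow> nat set" where
  "nbrs n G x = {w \<in> {..<n}. {x, w} \<in> G}"

lemma nbrs_eq_Diff_common_nonnbrs: "nbrs n G x = {..<n} - common_nonnbrs n G {x}"
  by (auto simp: nbrs_def common_nonnbrs_def insert_commute)

lemma card_nbrs_bounds:
  assumes "quasirandom n p k \<delta> G" "1 \<le> k" "x < n"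
  shows "real (card (nbrs n G x)) \<le> (p + \<delta>) * real n"
    and "(p - \<delta>) * real n \<le> real (card (nbrs n G x))"
proof -
  let ?N = "common_nonnbrs n G {x}"
  have N: "?N \<subseteq> {..<n}" by (auto simp: common_nonnbrs_def)
  have "real (card (nbrs n G x)) = real n - real (card ?N)"
    using N card_mono[OF _ N]
    by (simp add: nbrs_eq_Diff_common_nonnbrs card_Diff_subset of_nat_diff)
  then show "real (card (nbrs n G x)) \<le> (p + \<delta>) * real n"
    and "(p - \<delta>) * real n \<le> real (card (nbrs n G x))"
    using quasirandom_bounds[OF assms(1), of "{x}"] assms(2,3) by (auto simp: algebra_simps)
qed

lemma card_common_nbrs_ge:
  assumes quasi: "quasirandom n p k \<delta> G" and k: "2 \<le> k" and xy: "x < n" "y < n" "x \<noteq> y"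
  shows "(p\<^sup>2 - 3 * \<delta>) * real n \<le> real (card (nbrs n G x \<inter> nbrs n G y))"
proof -
  let ?N = "common_nonnbrs n G" and ?C = "nbrs n G x \<inter> nbrs n G y"
  let ?U = "?N {x} \<union> ?N {y}"
  have U: "?U \<subseteq> {..<n}" by (auto simp: common_nonnbrs_def)
  have "?C = {..<n} - ?U" by (auto simp: nbrs_eq_Diff_common_nonnbrs)
  then have "real (card ?C) = real n - real (card ?U)"
    using U card_mono[OF _ U] by (simp add: card_Diff_subset of_nat_diff)
  moreover have "?N {x} \<inter> ?N {y} = ?N {x, y}" by (auto simp: common_nonnbrs_def)
  then have "real (card ?U) = real (card (?N {x})) + real (card (?N {y})) - real (card (?N {x, y}))"
    using card_Un_Int[of "?N {x}" "?N {y}"] by simp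
  moreover have "real (card (?N {x})) \<le> (1 - p + \<delta>) * real n"
    "real (card (?N {y})) \<le> (1 - p + \<delta>) * real n"
    "((1 - p)\<^sup>2 - \<delta>) * real n \<le> real (card (?N {x, y}))"
    using quasirandom_bounds[OF quasi, of "{x}"] quasirandom_bounds[OF quasi, of "{y}"]
      quasirandom_bounds[OF quasi, of "{x, y}"] xy k by (auto simp: power2_eq_square)
  ultimately show ?thesis by (simp add: power2_eq_square algebra_simps)
qed

lemma ex_triangle_at:
  assumes quasi: "quasirandom n p k \<delta> G" and k: "2 \<le> k" and x: "x < n"
    and p: "0 < p" "p \<le> 1" and \<delta>: "3 * \<delta> < p\<^sup>2"
  obtains y z where "{x, y} \<in> G" "{x, z} \<in> G" "{y, z} \<in> G"
proof -
  have "p\<^sup>2 \<le> p" using p by (simp add: power2_eq_square mult_left_le)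
  then have "0 < (p - \<delta>) * real n" using x p \<delta> by simp
  also have "\<dots> \<le> real (card (nbrs n G x))"
    using k x by (intro card_nbrs_bounds(2)[OF quasi]) auto
  finally obtain y where y: "y < n" "{x, y} \<in> G"
    by (auto simp: card_gt_0_iff nbrs_def)
  then have "x \<noteq> y"
    using quasi all_edges_iff by (auto simp: quasirandom_def)
  have "0 < (p\<^sup>2 - 3 * \<delta>) * real n" using x \<delta> by simp
  also have "\<dots> \<le> real (card (nbrs n G x \<inter> nbrs n G y))"
    using k x y(1) \<open>x \<noteq> y\<close> by (intro card_common_nbrs_ge[OF quasi]) auto
  finally obtain z where "{x, z} \<in> G" "{y, z} \<in> G"
    by (auto simp: card_gt_0_iff nbrs_def)
  with y(2) show ?thesis by (rule that)
qed

lemma ex_related_to_fraction: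
  fixes R :: "'a set" and D :: "'b set" and P :: "'a \<Rightarrow> 'b \<Rightarrow> bool" and \<beta> :: real
  assumes fin: "finite R" "finite D" and "D \<noteq> {}"
    and degrees_ge: "\<And>x. x \<in> R \<Longrightarrow> \<beta> * real (card D) \<le> real (card {w \<in> D. P x w})"
  shows "\<exists>w\<in>D. \<beta> * real (card R) \<le> real (card {x \<in> R. P x w})"
proof (rule ccontr)
  assume "\<not> ?thesis"
  then have "(\<Sum>w\<in>D. real (card {x \<in> R. P x w})) < (\<Sum>w\<in>D. \<beta> * real (card R))"
    using fin \<open>D \<noteq> {}\<close> by (intro sum_strict_mono) auto
  also have "\<dots> = (\<Sum>x\<in>R. \<beta> * real (card D))" by simp
  also have "\<dots> \<le> (\<Sum>x\<in>R. real (card {w \<in> D. P x w}))"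
    by (intro sum_mono degrees_ge)
  also have "\<dots> = (\<Sum>w\<in>D. real (card {x \<in> R. P x w}))"
    using sum_multicount_gen[OF fin, of P] by (simp flip: of_nat_sum)
  finally show False by simp
qed

lemma ex_vertex_shrinking_common_nonnbrs:
  assumes D: "finite D" "D \<noteq> {}"
    and degrees_ge: "\<And>x. x \<in> common_nonnbrs n G S \<Longrightarrow>
      \<beta> * real (card D) \<le> real (card (D \<inter> nbrs n G x))"
  shows "\<exists>w\<in>D. real (card (common_nonnbrs n G (insert w S)))
           \<le> (1 - \<beta>) * real (card (common_nonnbrs n G S))"
proof -
  let ?N = "common_nonnbrs n G"
  have "\<exists>w\<in>D. \<beta> * real (card (?N S)) \<le> real (card {x \<in> ?N S. w \<in> nbrs n G x})"
    using D degrees_ge by (intro ex_related_to_fraction) (auto simp: Int_def)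
  then obtain w
    where w: "w \<in> D" "\<beta> * real (card (?N S)) \<le> real (card {x \<in> ?N S. w \<in> nbrs n G x})"
    by blast
  let ?C = "{x \<in> ?N S. w \<in> nbrs n G x}" and ?N' = "?N (insert w S)"
  have "?N' \<inter> ?C = {}" and sub: "?N' \<union> ?C \<subseteq> ?N S"
    by (auto simp: common_nonnbrs_def nbrs_def)
  then have "card ?N' + card ?C = card (?N' \<union> ?C)"
    by (simp add: card_Un_disjoint)
  also have "\<dots> \<le> card (?N S)"
    using sub by (intro card_mono) auto
  finally have "real (card ?N') + real (card ?C) \<le> real (card (?N S))"
    by (simp flip: of_nat_add)
  with w(2) have "real (card ?N') \<le> (1 - \<beta>) * real (card (?N S))"
    by (simp add: algebra_simps)
  with w(1) show ?thesis by blast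
qed

lemma ex_dominating_sequence:
  assumes D: "finite D" "D \<noteq> {}" and \<beta>: "\<beta> \<le> 1"
    and degrees_ge: "\<And>x. x \<in> common_nonnbrs n G T \<Longrightarrow>
      \<beta> * real (card D) \<le> real (card (D \<inter> nbrs n G x))"
  obtains w where "range w \<subseteq> D"
    and "\<And>j. real (card (common_nonnbrs n G (T \<union> w ` {..<j})))
           \<le> (1 - \<beta>) ^ j * real (card (common_nonnbrs n G T))"
proof -
  let ?N = "common_nonnbrs n G"
  have "\<exists>w\<in>D. real (card (?N (insert w S))) \<le> (1 - \<beta>) * real (card (?N S))" if "T \<subseteq> S" for S
    using that degrees_ge by (intro ex_vertex_shrinking_common_nonnbrs D)
      (auto simp: common_nonnbrs_def)
  then obtain f where f: "\<And>S. T \<subseteq> S \<Longrightarrow> f S \<in> D"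
    "\<And>S. T \<subseteq> S \<Longrightarrow> real (card (?N (insert (f S) S))) \<le> (1 - \<beta>) * real (card (?N S))"
    by metis
  define S where "S = rec_nat T (\<lambda>_ A. insert (f A) A)"
  define w where "w j = f (S j)" for j
  have S_Suc: "S (Suc j) = insert (w j) (S j)" for j by (simp add: S_def w_def)
  have S: "S j = T \<union> w ` {..<j}" for j
  proof (induction j)
    case (Suc j)
    then show ?case by (auto simp: S_Suc lessThan_Suc)
  qed (simp add: S_def)
  then have T_subset: "T \<subseteq> S j" for j by simp
  show ?thesis
  proof
    show "range w \<subseteq> D" using f(1)[OF T_subset] by (auto simp: w_def)
    have "real (card (?N (S j))) \<le> (1 - \<beta>) ^ j * real (card (?N T))" for j
    proof (induction j)
      case (Suc j)
      have "real (card (?N (S (Suc j)))) \<le> (1 - \<beta>) * real (card (?N (S j)))"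
        unfolding S_Suc w_def by (rule f(2)[OF T_subset])
      also have "\<dots> \<le> (1 - \<beta>) * ((1 - \<beta>) ^ j * real (card (?N T)))"
        using Suc.IH \<beta> by (intro mult_left_mono) auto
      finally show ?case by simp
    qed (simp add: S_def)
    then show "real (card (?N (T \<union> w ` {..<j}))) \<le> (1 - \<beta>) ^ j * real (card (?N T))" for j
      by (simp flip: S)
  qed
qed

\<comment> \<open>Any vertex has at most \<open>(p + \<delta>) n\<close> neighbours, and any two at least \<open>(p\<^sup>2 - 3 \<delta>) n\<close> common ones.\<close>
definition covering_rate :: "real \<Rightarrow> real \<Rightarrow> real" where
  "covering_rate p \<delta> = (p\<^sup>2 - 3 * \<delta>) / (p + \<delta>)"

definition hub_cost :: "real \<Rightarrow> real \<Rightarrow> real" where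
  "hub_cost p \<delta> = 3 / 2 + ((1 - p) ^ 3 + \<delta>) * (1 + 1 / covering_rate p \<delta>)"

lemma hub_cost_0: "0 < p \<Longrightarrow> hub_cost p 0 = 3 / 2 + (1 - p) ^ 3 * (1 + 1 / p)"
  by (simp add: hub_cost_def covering_rate_def power2_eq_square)

lemma covering_rate_bounds:
  assumes "0 < p" "p \<le> 1" "0 \<le> \<delta>" "3 * \<delta> < p\<^sup>2"
  shows "0 < covering_rate p \<delta>" and "covering_rate p \<delta> \<le> 1"
proof -
  have "p\<^sup>2 \<le> p" using assms by (simp add: power2_eq_square mult_left_le)
  then show "0 < covering_rate p \<delta>" and "covering_rate p \<delta> \<le> 1"
    using assms by (simp_all add: covering_rate_def)
qed

lemma covering_rate_mult_card_nbrs_le: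
  assumes quasi: "quasirandom n p k \<delta> G" and k: "2 \<le> k" and xy: "x < n" "y < n" "x \<noteq> y"
    and p: "0 < p" "p \<le> 1" and \<delta>: "0 \<le> \<delta>" "3 * \<delta> < p\<^sup>2"
  shows "covering_rate p \<delta> * real (card (nbrs n G x)) \<le> real (card (nbrs n G x \<inter> nbrs n G y))"
proof -
  have "covering_rate p \<delta> * real (card (nbrs n G x)) \<le> covering_rate p \<delta> * ((p + \<delta>) * real n)"
    using card_nbrs_bounds(1)[OF quasi _ xy(1)] k covering_rate_bounds[OF p \<delta>]
    by (intro mult_left_mono) auto
  also have "\<dots> = (p\<^sup>2 - 3 * \<delta>) * real n" using p \<delta> by (simp add: covering_rate_def)
  also have "\<dots> \<le> real (card (nbrs n G x \<inter> nbrs n G y))"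
    using k xy by (intro card_common_nbrs_ge[OF quasi])
  finally show ?thesis .
qed

lemma ex_greedy_hubs:
  assumes quasi: "quasirandom n p k \<delta> G" and k: "3 \<le> k" and n: "0 < n"
    and p: "0 < p" "p \<le> 1" and \<delta>: "0 \<le> \<delta>" "3 * \<delta> < p\<^sup>2"
  obtains v where "\<And>i. 0 < i \<Longrightarrow> {v 0, v i} \<in> G" and "{v 1, v 2} \<in> G"
    and "\<And>j. real (card (common_nonnbrs n G (v ` {..<3 + j})))
           \<le> (1 - covering_rate p \<delta>) ^ j * (((1 - p) ^ 3 + \<delta>) * real n)"
proof -
  let ?N = "common_nonnbrs n G" and ?\<beta> = "covering_rate p \<delta>" and ?D = "nbrs n G 0"
  have edge: "x < n \<and> y < n \<and> x \<noteq> y" if "{x, y} \<in> G" for x y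
    using that quasi all_edges_iff by (auto simp: quasirandom_def)
  obtain b c where triangle: "{0, b} \<in> G" "{0, c} \<in> G" "{b, c} \<in> G"
    using ex_triangle_at[OF quasi _ n p] k \<delta> by auto
  have D: "finite ?D" "?D \<noteq> {}" using triangle edge by (auto simp: nbrs_def)
  have degrees_ge: "?\<beta> * real (card ?D) \<le> real (card (?D \<inter> nbrs n G x))" if "x \<in> ?N {0, b, c}" for x
  proof -
    have "x < n" "0 \<noteq> x" using that triangle(1) unfolding common_nonnbrs_def by blast+
    then show ?thesis using covering_rate_mult_card_nbrs_le[OF quasi _ n _ _ p \<delta>] k by simp
  qed
  obtain w where w: "range w \<subseteq> ?D"
    "\<And>j. real (card (?N ({0, b, c} \<union> w ` {..<j}))) \<le> (1 - ?\<beta>) ^ j * real (card (?N {0, b, c}))"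
    using ex_dominating_sequence[OF D covering_rate_bounds(2)[OF p \<delta>] degrees_ge] by blast
  have triangle_nonnbrs_le: "real (card (?N {0, b, c})) \<le> ((1 - p) ^ 3 + \<delta>) * real n"
    using quasirandom_bounds(1)[OF quasi, of "{0, b, c}"] triangle edge k
    by (auto simp: card_insert_if power3_eq_cube mult.assoc)
  define v where "v = case_nat 0 (case_nat b (case_nat c w))"
  show ?thesis
  proof
    show "{v 0, v i} \<in> G" if "0 < i" for i
      using that triangle w(1) by (auto simp: v_def nbrs_def split: nat.split)
    show "{v 1, v 2} \<in> G" using triangle by (simp add: v_def numeral_2_eq_2)
    show "real (card (?N (v ` {..<3 + j}))) \<le> (1 - ?\<beta>) ^ j * (((1 - p) ^ 3 + \<delta>) * real n)" for j
    proof -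
      have "v ` {..<3 + j} = {0, b, c} \<union> w ` {..<j}"
        by (simp add: v_def numeral_3_eq_3 lessThan_Suc_eq_insert_0 image_image)
      then have "real (card (?N (v ` {..<3 + j}))) \<le> (1 - ?\<beta>) ^ j * real (card (?N {0, b, c}))"
        using w(2) by simp
      also have "\<dots> \<le> (1 - ?\<beta>) ^ j * (((1 - p) ^ 3 + \<delta>) * real n)"
        using triangle_nonnbrs_le covering_rate_bounds(2)[OF p \<delta>] by (intro mult_left_mono) auto
      finally show ?thesis .
    qed
  qed
qed

lemma sum_power_le_inverse:
  fixes \<beta> :: real
  assumes "0 < \<beta>" "\<beta> \<le> 1"
  shows "(\<Sum>j\<le>l. (1 - \<beta>) ^ j) \<le> 1 / \<beta>"
proof -
  have "\<beta> * (\<Sum>j\<le>l. (1 - \<beta>) ^ j) = 1 - (1 - \<beta>) ^ Suc l"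
    using sum_gp_basic[of "1 - \<beta>" l] by simp
  also have "\<dots> \<le> 1" using assms by simp
  finally show ?thesis using assms by (simp add: field_simps)
qed

theorem sat_C4_le_if_quasirandom:
  assumes quasi: "quasirandom n p k \<delta> G" and k: "3 \<le> k" and n: "0 < n"
    and p: "0 < p" "p \<le> 1" and \<delta>: "0 \<le> \<delta>" "3 * \<delta> < p\<^sup>2"
    and covered: "(1 - covering_rate p \<delta>) ^ l * (((1 - p) ^ 3 + \<delta>) * real n) < 1"
  shows "real (sat_C4 G) \<le> hub_cost p \<delta> * real n + 2 * (real (3 + l))\<^sup>2"
proof -
  define \<beta> where "\<beta> = covering_rate p \<delta>"
  define A where "A = ((1 - p) ^ 3 + \<delta>) * real n"
  have \<beta>: "0 < \<beta>" "\<beta> \<le> 1" unfolding \<beta>_def by (rule covering_rate_bounds[OF p \<delta>])+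
  have "0 \<le> A" using p \<delta> by (simp add: A_def)
  obtain v where v: "\<And>i. 0 < i \<Longrightarrow> {v 0, v i} \<in> G" "{v 1, v 2} \<in> G"
    and common_nonnbrs_le: "\<And>j. real (card (common_nonnbrs n G (v ` {..<3 + j}))) \<le> (1 - \<beta>) ^ j * A"
    using ex_greedy_hubs[OF quasi k n p \<delta>] unfolding \<beta>_def A_def by metis
  define N where "N j = real (card (common_nonnbrs n G (v ` {..<j})))" for j
  interpret hub_system n G "3 + l" v
  proof
    have "real (card (common_nonnbrs n G (v ` {..<3 + l}))) < 1"
      using common_nonnbrs_le[of l] covered unfolding \<beta>_def A_def by linarith
    then have "card (common_nonnbrs n G (v ` {..<3 + l})) < 1" by linarith
    then show "common_nonnbrs n G (v ` {..<3 + l}) = {}" by simp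
  qed (use quasi v in \<open>auto simp: quasirandom_def\<close>)
  have "(\<Sum>i=1..<3 + l. N (max 3 (Suc i))) = N 3 + (\<Sum>j\<le>l. N (3 + j))"
    by (induction l) (simp_all add: numeral_eq_Suc)
  also have "\<dots> \<le> A + (\<Sum>j\<le>l. (1 - \<beta>) ^ j * A)"
    using common_nonnbrs_le[of 0]
    by (intro add_mono sum_mono) (simp_all add: N_def common_nonnbrs_le)
  also have "\<dots> \<le> A + 1 / \<beta> * A"
    using sum_power_le_inverse[OF \<beta>] \<open>0 \<le> A\<close>
    by (simp only: sum_distrib_right[symmetric] add_left_mono mult_right_mono)
  finally have "(\<Sum>i=1..<3 + l. N (max 3 (Suc i))) \<le> (1 + 1 / \<beta>) * A"
    by (simp add: algebra_simps)
  with sat_C4_le show ?thesis by (simp add: N_def A_def \<beta>_def hub_cost_def algebra_simps)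
qed

section \<open>Quasirandomness of the random graph\<close>

lemma prob_Pi_pmf_bernoulli_all_False:
  assumes "finite A" "B \<subseteq> A" "0 \<le> p" "p \<le> 1"
  shows "measure_pmf.prob (Pi_pmf A d (\<lambda>_. bernoulli_pmf p)) {f. \<forall>e\<in>B. \<not> f e} = (1 - p) ^ card B"
proof -
  have "{f. \<forall>e\<in>B. \<not> f e} = Pi A (\<lambda>e. if e \<in> B then {False} else UNIV)"
    using assms(2) by (auto simp: Pi_def split: if_splits)
  then have "measure_pmf.prob (Pi_pmf A d (\<lambda>_. bernoulli_pmf p)) {f. \<forall>e\<in>B. \<not> f e} =
      (\<Prod>e\<in>A. measure_pmf.prob (bernoulli_pmf p) (if e \<in> B then {False} else UNIV))"
    using assms(1) by (simp only: measure_Pi_pmf_Pi)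
  also have "\<dots> = (\<Prod>e\<in>A. if e \<in> B then 1 - p else 1)"
    using assms(3,4) by (intro prod.cong) (auto simp: measure_pmf_single)
  also have "\<dots> = (1 - p) ^ card B"
    using assms(1,2) by (simp add: prod.If_cases Int_absorb1)
  finally show ?thesis .
qed

lemma indep_vars_Pi_pmf_all_False:
  assumes A: "finite A" "\<And>x. x \<in> I \<Longrightarrow> B x \<subseteq> A" and disj: "disjoint_family_on B I"
  shows "prob_space.indep_vars (measure_pmf (Pi_pmf A d P)) (\<lambda>_. borel)
           (\<lambda>x f. of_bool (\<forall>e\<in>B x. \<not> f e) :: real) I"
proof -
  have restrict: "prob_space.indep_vars (measure_pmf (Pi_pmf A d P))
          (\<lambda>x. PiM (B x) (\<lambda>_. count_space UNIV)) (\<lambda>x f. restrict (\<lambda>e. f e) (B x)) I"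
    by (rule prob_space.indep_vars_restrict[OF measure_pmf.prob_space_axioms indep_vars_Pi_pmf])
      (use A disj in auto)
  have "prob_space.indep_vars (measure_pmf (Pi_pmf A d P)) (\<lambda>_. borel)
          (\<lambda>x f. (\<lambda>g. of_bool (\<forall>e\<in>B x. \<not> g e) :: real) (restrict (\<lambda>e. f e) (B x))) I"
  proof (rule prob_space.indep_vars_compose2[OF measure_pmf.prob_space_axioms restrict])
    fix x assume "x \<in> I"
    then have "finite (B x)" using A finite_subset by blast
    then show "(\<lambda>g. of_bool (\<forall>e\<in>B x. \<not> g e) :: real) \<in> PiM (B x) (\<lambda>_. count_space UNIV) \<rightarrow>\<^sub>M borel"
      by measurable
  qed
  then show ?thesis by (simp cong: ball_cong)
qed

lemma prob_card_all_False_blocks_deviation: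
  assumes A: "finite A" "\<And>x. x \<in> I \<Longrightarrow> B x \<subseteq> A" and disj: "disjoint_family_on B I"
    and I: "finite I" "I \<noteq> {}" and k: "\<And>x. x \<in> I \<Longrightarrow> card (B x) = k"
    and p: "0 \<le> p" "p \<le> 1" and t: "0 \<le> t"
  shows "measure_pmf.prob (Pi_pmf A d (\<lambda>_. bernoulli_pmf p))
           {f. t \<le> \<bar>real (card {x \<in> I. \<forall>e\<in>B x. \<not> f e}) - (1 - p) ^ k * real (card I)\<bar>}
         \<le> 2 * exp (- 2 * t\<^sup>2 / real (card I))"
proof -
  define M where "M = Pi_pmf A d (\<lambda>_. bernoulli_pmf p)"
  define X where "X = (\<lambda>x f. of_bool (\<forall>e\<in>B x. \<not> f e) :: real)"
  define \<mu> where "\<mu> = (\<Sum>x\<in>I. measure_pmf.expectation M (X x))"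
  interpret Hoeffding_ineq "measure_pmf M" I X "\<lambda>_. 0" "\<lambda>_. 1" \<mu>
    using indep_vars_Pi_pmf_all_False[OF A disj] I
    by unfold_locales (auto simp: X_def M_def \<mu>_def)
  have "measure_pmf.expectation M (X x) = (1 - p) ^ k" if "x \<in> I" for x
  proof -
    have "X x = indicator {f. \<forall>e\<in>B x. \<not> f e}" by (auto simp: X_def indicator_def)
    then show ?thesis
      using prob_Pi_pmf_bernoulli_all_False[OF A(1) A(2)[OF that] p] k[OF that] by (simp add: M_def)
  qed
  then have "\<mu> = (1 - p) ^ k * real (card I)" by (simp add: \<mu>_def)
  moreover have "real (card {x \<in> I. \<forall>e\<in>B x. \<not> f e}) = (\<Sum>x\<in>I. X x f)" for f
    using I by (simp add: X_def Int_def)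
  moreover have "measure_pmf.prob M {f \<in> space (measure_pmf M). t \<le> \<bar>(\<Sum>x\<in>I. X x f) - \<mu>\<bar>}
      \<le> 2 * exp (- 2 * t\<^sup>2 / (\<Sum>x\<in>I. (1 - 0)\<^sup>2))"
    using t I by (intro Hoeffding_ineq_abs_ge) (auto simp: card_gt_0_iff)
  ultimately show ?thesis by (simp add: M_def)
qed

lemma prob_card_common_nonnbrs_outside_deviation:
  assumes T: "T \<subseteq> {..<n}" "card T < n" and p: "0 \<le> p" "p \<le> 1" and t: "0 \<le> t"
  shows "measure_pmf.prob (Gnp n p)
           {G. t \<le> \<bar>real (card (common_nonnbrs n G T - T)) - (1 - p) ^ card T * real (n - card T)\<bar>}
         \<le> 2 * exp (- 2 * t\<^sup>2 / real (n - card T))"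
proof -
  let ?I = "{..<n} - T" and ?B = "\<lambda>x. (\<lambda>t. {x, t}) ` T"
  have card_I: "card ?I = n - card T"
    using T finite_subset[OF T(1)] by (simp add: card_Diff_subset)
  have "?B x \<subseteq> all_edges n" if "x \<in> ?I" for x
    using that T by (auto simp: all_edges_iff)
  moreover have "disjoint_family_on ?B ?I"
    by (auto simp: disjoint_family_on_def doubleton_eq_iff)
  moreover have "?I \<noteq> {}" using T card_I by (metis card.empty less_numeral_extra(3) zero_less_diff)
  moreover have "card (?B x) = card T" for x
    by (intro card_image) (auto simp: inj_on_def doubleton_eq_iff)
  moreover have "common_nonnbrs n {e \<in> all_edges n. f e} T - T = {x \<in> ?I. \<forall>e\<in>?B x. \<not> f e}" for f
    using T by (auto simp: common_nonnbrs_def all_edges_iff)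
  ultimately show ?thesis
    using prob_card_all_False_blocks_deviation[of "all_edges n" ?I ?B "card T" p t False] p t
    by (simp add: Gnp_def vimage_def card_I)
qed

lemma prob_card_common_nonnbrs_deviation:
  assumes T: "T \<subseteq> {..<n}" "card T < n" "real (card T) \<le> \<delta> / 2 * real n"
    and p: "0 \<le> p" "p \<le> 1" and \<delta>: "0 \<le> \<delta>"
  shows "measure_pmf.prob (Gnp n p)
           {G. \<delta> * real n < \<bar>real (card (common_nonnbrs n G T)) - (1 - p) ^ card T * real n\<bar>}
         \<le> 2 * exp (- (\<delta>\<^sup>2 / 2) * real n)"
proof -
  let ?t = "\<delta> / 2 * real n" and ?q = "(1 - p) ^ card T" and ?N = "\<lambda>G. common_nonnbrs n G T"
  have q: "0 \<le> ?q" "?q \<le> 1" using p by (auto intro: power_le_one)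
  have large: "?t \<le> \<bar>real (card (?N G - T)) - ?q * real (n - card T)\<bar>"
    if "\<delta> * real n < \<bar>real (card (?N G)) - ?q * real n\<bar>" for G
  proof -
    have "card (?N G) = card (?N G - T) + card (?N G \<inter> T)"
      by (simp add: card_Diff_subset_Int card_mono)
    moreover have "card (?N G \<inter> T) \<le> card T"
      using T finite_subset[OF T(1)] by (intro card_mono) auto
    moreover have "?q * real n = ?q * real (n - card T) + ?q * real (card T)"
      using T by (simp add: algebra_simps of_nat_diff)
    moreover have "0 \<le> ?q * real (card T)" "?q * real (card T) \<le> real (card T)"
      using q by (auto intro: mult_left_le_one_le)
    ultimately show ?thesis using that T(3) by linarith
  qed
  then have "measure_pmf.prob (Gnp n p) {G. \<delta> * real n < \<bar>real (card (?N G)) - ?q * real n\<bar>}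
      \<le> measure_pmf.prob (Gnp n p) {G. ?t \<le> \<bar>real (card (?N G - T)) - ?q * real (n - card T)\<bar>}"
    by (intro measure_pmf.finite_measure_mono) auto
  also have "\<dots> \<le> 2 * exp (- 2 * ?t\<^sup>2 / real (n - card T))"
    using \<delta> by (intro prob_card_common_nonnbrs_outside_deviation T p) auto
  also have "- 2 * ?t\<^sup>2 / real (n - card T) \<le> - 2 * ?t\<^sup>2 / real n"
    using T(2) by (intro divide_left_mono_neg) auto
  then have "2 * exp (- 2 * ?t\<^sup>2 / real (n - card T)) \<le> 2 * exp (- 2 * ?t\<^sup>2 / real n)" by simp
  also have "- 2 * ?t\<^sup>2 / real n = - (\<delta>\<^sup>2 / 2) * real n"
    by (simp add: power2_eq_square field_simps)
  finally show ?thesis .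
qed

lemma card_bounded_subsets_le:
  assumes "finite A"
  shows "card {T. T \<subseteq> A \<and> card T \<le> k} \<le> (\<Sum>i\<le>k. card A ^ i)"
proof -
  have "{T. T \<subseteq> A \<and> card T \<le> k} = (\<Union>i\<le>k. {T. T \<subseteq> A \<and> card T = i})" by auto
  then have "card {T. T \<subseteq> A \<and> card T \<le> k} \<le> (\<Sum>i\<le>k. card {T. T \<subseteq> A \<and> card T = i})"
    by (simp add: card_UN_le)
  also have "\<dots> = (\<Sum>i\<le>k. card A choose i)" using assms by (simp add: n_subsets)
  also have "\<dots> \<le> (\<Sum>i\<le>k. card A ^ i)"
  proof (rule sum_mono)
    show "card A choose i \<le> card A ^ i" for i
      by (cases "i \<le> card A") (simp_all add: binomial_le_pow binomial_eq_0)
  qed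
  finally show ?thesis .
qed

lemma prob_not_quasirandom_le:
  assumes n: "k < n" "real k \<le> \<delta> / 2 * real n" and p: "0 \<le> p" "p \<le> 1" and \<delta>: "0 \<le> \<delta>"
  shows "measure_pmf.prob (Gnp n p) {G. \<not> quasirandom n p k \<delta> G}
         \<le> (\<Sum>i\<le>k. real n ^ i) * (2 * exp (- (\<delta>\<^sup>2 / 2) * real n))"
proof -
  define \<T> where "\<T> = {T. T \<subseteq> {..<n} \<and> card T \<le> k}"
  define B where "B T = {G. \<delta> * real n
      < \<bar>real (card (common_nonnbrs n G T)) - (1 - p) ^ card T * real n\<bar>}" for T
  have "{G. \<not> quasirandom n p k \<delta> G} \<inter> set_pmf (Gnp n p) \<subseteq> (\<Union>T\<in>\<T>. B T)"
    by (auto simp: quasirandom_def \<T>_def B_def Gnp_def not_le)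
  then have "measure_pmf.prob (Gnp n p) {G. \<not> quasirandom n p k \<delta> G}
      \<le> measure_pmf.prob (Gnp n p) (\<Union>T\<in>\<T>. B T)"
    by (metis measure_Int_set_pmf measure_pmf.finite_measure_mono sets_measure_pmf UNIV_I sets_UNIV)
  also have "\<dots> \<le> (\<Sum>T\<in>\<T>. measure_pmf.prob (Gnp n p) (B T))"
    unfolding \<T>_def by (intro measure_pmf.finite_measure_subadditive_finite) auto
  also have "\<dots> \<le> (\<Sum>T\<in>\<T>. 2 * exp (- (\<delta>\<^sup>2 / 2) * real n))"
    unfolding B_def using n p \<delta>
    by (intro sum_mono prob_card_common_nonnbrs_deviation) (auto simp: \<T>_def)
  also have "\<dots> \<le> (\<Sum>i\<le>k. real n ^ i) * (2 * exp (- (\<delta>\<^sup>2 / 2) * real n))"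
  proof -
    have "real (card \<T>) \<le> real (\<Sum>i\<le>k. n ^ i)"
      using card_bounded_subsets_le[of "{..<n}" k] unfolding \<T>_def of_nat_le_iff by simp
    then show ?thesis by (simp add: mult_right_mono)
  qed
  finally show ?thesis .
qed

theorem Gnp_quasirandom_tendsto_1:
  assumes p: "0 \<le> p" "p \<le> 1" and \<delta>: "0 < \<delta>"
  shows "(\<lambda>n. measure_pmf.prob (Gnp n p) {G. quasirandom n p k \<delta> G}) \<longlonglongrightarrow> 1"
proof (rule tendsto_sandwich[where h = "\<lambda>_. 1"])
  define F where "F n = (\<Sum>i\<le>k. real n ^ i) * (2 * exp (- (\<delta>\<^sup>2 / 2) * real n))" for n :: nat
  have "(\<lambda>n. real n ^ i * (2 * exp (- (\<delta>\<^sup>2 / 2) * real n))) \<longlonglongrightarrow> 0" for i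
    using \<delta> by real_asymp
  then have "F \<longlonglongrightarrow> (\<Sum>i\<le>k. 0)"
    unfolding F_def sum_distrib_right by (intro tendsto_intros)
  then show "(\<lambda>n. 1 - F n) \<longlonglongrightarrow> 1"
    by (auto intro!: tendsto_eq_intros)
  have "eventually (\<lambda>n. real k \<le> \<delta> / 2 * real n) sequentially"
    using \<delta> by real_asymp
  then show "eventually (\<lambda>n. 1 - F n
      \<le> measure_pmf.prob (Gnp n p) {G. quasirandom n p k \<delta> G}) sequentially"
    using eventually_gt_at_top[of k]
  proof eventually_elim
    case (elim n)
    have "measure_pmf.prob (Gnp n p) {G. \<not> quasirandom n p k \<delta> G}
        = 1 - measure_pmf.prob (Gnp n p) {G. quasirandom n p k \<delta> G}"
      using measure_pmf.prob_compl[of "{G. quasirandom n p k \<delta> G}" "Gnp n p"]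
      by (simp add: Collect_neg_eq Compl_eq_Diff_UNIV)
    moreover have "measure_pmf.prob (Gnp n p) {G. \<not> quasirandom n p k \<delta> G} \<le> F n"
      unfolding F_def using elim p \<delta> by (intro prob_not_quasirandom_le) auto
    ultimately show ?case by linarith
  qed
qed simp_all

section \<open>Saturation in the random graph\<close>

lemma ex_hub_cost_less:
  assumes p: "0 < p" and cost_less: "hub_cost p 0 < c"
  obtains \<delta> where "0 < \<delta>" "3 * \<delta> < p\<^sup>2" "hub_cost p \<delta> < c"
proof -
  have "(hub_cost p \<longlongrightarrow> hub_cost p 0) (at_right 0)"
    unfolding hub_cost_def covering_rate_def using p by (auto intro!: tendsto_eq_intros)
  then have "eventually (\<lambda>\<delta>. hub_cost p \<delta> < c) (at_right 0)"
    using cost_less by (rule order_tendstoD)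
  moreover have "eventually (\<lambda>\<delta>. 0 < \<delta> \<and> \<delta> < p\<^sup>2 / 3) (at_right 0)"
    using p by (intro eventually_at_rightI[of 0 "p\<^sup>2 / 3"]) auto
  ultimately have "eventually (\<lambda>\<delta>. 0 < \<delta> \<and> 3 * \<delta> < p\<^sup>2 \<and> hub_cost p \<delta> < c) (at_right 0)"
    by eventually_elim simp
  then show ?thesis
    using eventually_happens'[OF trivial_limit_at_right_real] that by blast
qed

lemma one_minus_power_ceiling_le_exp:
  fixes \<beta> x :: real
  assumes "0 \<le> \<beta>" "\<beta> \<le> 1"
  shows "(1 - \<beta>) ^ nat \<lceil>x\<rceil> \<le> exp (- \<beta> * x)"
proof -
  have "(1 - \<beta>) ^ nat \<lceil>x\<rceil> \<le> exp (- \<beta>) ^ nat \<lceil>x\<rceil>"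
    using assms exp_ge_add_one_self[of "- \<beta>"] by (intro power_mono) auto
  also have "\<dots> = exp (- (\<beta> * real (nat \<lceil>x\<rceil>)))" by (simp add: mult.commute flip: exp_of_nat_mult)
  also have "\<dots> \<le> exp (- (\<beta> * x))"
    using assms by (simp add: mult_left_mono real_nat_ceiling_ge)
  finally show ?thesis by simp
qed

lemma eventually_quasirandom_imp_sat_C4_le:
  assumes p: "0 < p" "p \<le> 1" and \<delta>: "0 \<le> \<delta>" "3 * \<delta> < p\<^sup>2" and cost_less: "hub_cost p \<delta> < c"
  shows "eventually (\<lambda>n. \<forall>G. quasirandom n p 3 \<delta> G \<longrightarrow> real (sat_C4 G) \<le> c * real n) sequentially"
proof -
  define \<beta> where "\<beta> = covering_rate p \<delta>"
  define A where "A = (1 - p) ^ 3 + \<delta>"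
  have \<beta>: "0 < \<beta>" "\<beta> \<le> 1" unfolding \<beta>_def by (rule covering_rate_bounds[OF p \<delta>])+
  have "0 \<le> A" using p \<delta> by (simp add: A_def)
  have "(\<lambda>n. exp (- \<beta> * real n powr (1 / 4)) * (A * real n)) \<longlonglongrightarrow> 0"
    using \<beta> by real_asymp
  then have "eventually (\<lambda>n. exp (- \<beta> * real n powr (1 / 4)) * (A * real n) < 1) sequentially"
    by (rule order_tendstoD) simp
  moreover have "0 < c - hub_cost p \<delta>" using cost_less by simp
  then have "eventually (\<lambda>n.
      2 * (4 + real n powr (1 / 4))\<^sup>2 \<le> (c - hub_cost p \<delta>) * real n) sequentially"
    by real_asymp
  ultimately show ?thesis
    using eventually_gt_at_top[of 0]
  proof eventually_elim
    case (elim n)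
    define l where "l = nat \<lceil>real n powr (1 / 4)\<rceil>"
    have "(1 - \<beta>) ^ l * (A * real n) \<le> exp (- \<beta> * real n powr (1 / 4)) * (A * real n)"
      unfolding l_def using \<beta> \<open>0 \<le> A\<close> by (intro mult_right_mono one_minus_power_ceiling_le_exp) auto
    with elim have dominated: "(1 - \<beta>) ^ l * (A * real n) < 1" by linarith
    have "real l \<le> real n powr (1 / 4) + 1" by (simp add: l_def)
    then have "2 * (real (3 + l))\<^sup>2 \<le> 2 * (4 + real n powr (1 / 4))\<^sup>2"
      by (intro mult_left_mono power_mono) auto
    also have "\<dots> \<le> (c - hub_cost p \<delta>) * real n" using elim by blast
    finally have "hub_cost p \<delta> * real n + 2 * (real (3 + l))\<^sup>2 \<le> c * real n"
      by (simp add: algebra_simps)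
    moreover have "real (sat_C4 G) \<le> hub_cost p \<delta> * real n + 2 * (real (3 + l))\<^sup>2"
      if "quasirandom n p 3 \<delta> G" for G
      using sat_C4_le_if_quasirandom[OF that _ _ p \<delta>] dominated elim by (auto simp: A_def \<beta>_def)
    ultimately show ?case by (meson order_trans)
  qed
qed

theorem Gnp_sat_C4_le_tendsto_1:
  assumes p: "0 < p" "p \<le> 1" and cost_less: "hub_cost p 0 < c"
  shows "(\<lambda>n. measure_pmf.prob (Gnp n p) {G. real (sat_C4 G) \<le> c * real n}) \<longlonglongrightarrow> 1"
proof -
  obtain \<delta> where \<delta>: "0 < \<delta>" "3 * \<delta> < p\<^sup>2" "hub_cost p \<delta> < c"
    using ex_hub_cost_less[OF p(1) cost_less] .
  show ?thesis
  proof (rule tendsto_sandwich[where h = "\<lambda>_. 1"])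
    show "(\<lambda>n. measure_pmf.prob (Gnp n p) {G. quasirandom n p 3 \<delta> G}) \<longlonglongrightarrow> 1"
      using p \<delta> by (intro Gnp_quasirandom_tendsto_1) auto
    have "eventually (\<lambda>n. \<forall>G. quasirandom n p 3 \<delta> G \<longrightarrow> real (sat_C4 G) \<le> c * real n) sequentially"
      using p \<delta> by (intro eventually_quasirandom_imp_sat_C4_le) auto
    then show "eventually (\<lambda>n. measure_pmf.prob (Gnp n p) {G. quasirandom n p 3 \<delta> G}
        \<le> measure_pmf.prob (Gnp n p) {G. real (sat_C4 G) \<le> c * real n}) sequentially"
      by eventually_elim (auto intro!: measure_pmf.finite_measure_mono)
  qed simp_all
qed

section \<open>Comparison of the constants\<close>

lemma hub_cost_0_less_dense_constant:
  fixes p :: real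
  assumes p: "0 < p" "p < 1"
  defines "q \<equiv> 1 - p"
  shows "hub_cost p 0 < 3 * (1 + q ^ 3) / (2 * (1 - q ^ 3))"
proof -
  have q: "0 < q" "q < 1" using p by (auto simp: q_def)
  have cube_less_1: "q ^ 3 < 1" using q by (simp add: power_less_one_iff)
  have "0 < (1 - q) * (1 - q\<^sup>2)"
    using q by (simp add: power_less_one_iff)
  then have "(1 + p) * (1 + q + q\<^sup>2) < 3"
    by (simp add: q_def power2_eq_square algebra_simps)
  then have "p * ((1 + p) * (1 + q + q\<^sup>2)) < p * 3"
    using p by (intro mult_strict_left_mono)
  moreover have "1 - q ^ 3 = p * (1 + q + q\<^sup>2)"
    by (simp add: q_def power2_eq_square power3_eq_cube algebra_simps)
  ultimately have "(1 + p) * (1 - q ^ 3) < 3 * p" by (simp add: mult_ac)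
  then have "1 + 1 / p < 3 / (1 - q ^ 3)"
    using p cube_less_1 by (simp add: field_simps)
  then have "q ^ 3 * (1 + 1 / p) < q ^ 3 * (3 / (1 - q ^ 3))"
    using q by (intro mult_strict_left_mono) auto
  moreover have "3 / 2 + q ^ 3 * (3 / (1 - q ^ 3)) = 3 * (1 + q ^ 3) / (2 * (1 - q ^ 3))"
    using cube_less_1 by (simp add: field_simps)
  ultimately show ?thesis using p by (simp add: hub_cost_0 q_def)
qed

lemma ge_8_if_power_small:
  fixes q :: real and s :: nat
  assumes s: "0 < s" "(2 * real s ^ 2 + 1) * q ^ s < 1" and q: "0 < q" "1 / 7 \<le> q ^ 3"
  shows "8 \<le> s"
proof (rule ccontr)
  assume "\<not> 8 \<le> s"
  then have small: "s \<in> {1, 2, 3, 4, 5, 6, 7}" using s by auto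
  have "((2 * real s ^ 2 + 1) * q ^ s) ^ 3 < 1"
    using s q by (intro power_less_one_iff[THEN iffD2]) auto
  then have "(2 * real s ^ 2 + 1) ^ 3 * (q ^ 3) ^ s < 1"
    by (simp add: power_mult_distrib mult.commute flip: power_mult)
  moreover have "(2 * real s ^ 2 + 1) ^ 3 * (1 / 7) ^ s \<le> (2 * real s ^ 2 + 1) ^ 3 * (q ^ 3) ^ s"
    using q by (intro mult_left_mono power_mono) auto
  ultimately have "(2 * real s ^ 2 + 1) ^ 3 * (1 / 7) ^ s < 1" by linarith
  with small show False by (auto simp: power_divide)
qed

lemma mult_ge_2_if_power_small:
  fixes p :: real and s :: nat
  assumes s: "8 \<le> s" "(2 * real s ^ 2 + 1) * (1 - p) ^ s < 1" and p: "0 < p"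
  shows "2 \<le> real s * p"
proof (rule ccontr)
  assume "\<not> 2 \<le> real s * p"
  then have mult_less_2: "real s * p < 2" by simp
  have "8 * p \<le> real s * p" using s p by (intro mult_right_mono) auto
  with mult_less_2 have p_less: "p < 1 / 4" by simp
  have "p * p \<le> p / 4" using p p_less by (simp add: mult_left_le)
  then have "1 \<le> (1 - p) * (1 + 2 * p)" using p by (simp add: algebra_simps)
  also have "\<dots> \<le> (1 - p) * exp (2 * p)"
    using p_less exp_ge_add_one_self[of "2 * p"] by (intro mult_left_mono) auto
  finally have "1 \<le> ((1 - p) * exp (2 * p)) ^ s" by (rule one_le_power)
  also have "\<dots> = (1 - p) ^ s * exp (2 * (real s * p))"
    by (simp add: power_mult_distrib mult_ac flip: exp_of_nat_mult)
  also have "\<dots> \<le> (1 - p) ^ s * exp 4"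
    using p_less mult_less_2 by (intro mult_left_mono) (auto simp: mult.commute)
  also have "exp (4 :: real) = exp 1 ^ 4" by (simp flip: exp_of_nat_mult)
  also have "(1 - p) ^ s * \<dots> \<le> (1 - p) ^ s * 3 ^ 4"
    using p_less by (intro mult_left_mono power_mono exp_le) auto
  also have "\<dots> \<le> (1 - p) ^ s * (2 * real s ^ 2 + 1)"
  proof (intro mult_left_mono)
    have "8 ^ 2 \<le> real s ^ 2" using s by (intro power_mono) auto
    then show "(3 :: real) ^ 4 \<le> 2 * real s ^ 2 + 1" by simp
  qed (use p_less in auto)
  finally show False using s(2) by (simp add: mult.commute)
qed

lemma hub_cost_0_less_sparse_constant:
  fixes p :: real and s :: nat
  assumes p: "0 < p" "p < 1"
  defines "q \<equiv> 1 - p"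
  assumes cube_ge: "1 / 7 \<le> q ^ 3" and s: "0 < s" "(2 * real s ^ 2 + 1) * q ^ s < 1"
  shows "hub_cost p 0
    < (real s + 1) / 2 + real s * q ^ s + real s * q ^ (2 * s) / (1 - q ^ s)"
proof -
  have q: "0 < q" "q < 1" using p by (auto simp: q_def)
  have "2 \<le> real s * p"
    using ge_8_if_power_small[OF s q(1) cube_ge] s(2) p(1) unfolding q_def
    by (intro mult_ge_2_if_power_small)
  then have "1 / p \<le> real s / 2" using p by (simp add: field_simps)
  moreover have "q ^ 3 * (1 + 1 / p) \<le> 1 / p - 1"
  proof -
    have "q * (1 + p) \<le> 1" by (simp add: q_def algebra_simps)
    moreover have "q\<^sup>2 \<le> q" using q by (simp add: power2_eq_square mult_left_le)
    ultimately have "q\<^sup>2 * (q * (1 + p)) \<le> q * 1" using p q by (intro mult_mono) auto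
    then have "q ^ 3 * (1 + p) / p \<le> q / p"
      using p by (intro divide_right_mono) (auto simp: power3_eq_cube power2_eq_square mult.assoc)
    moreover have "q ^ 3 * (1 + p) / p = q ^ 3 * (1 + 1 / p)" "q / p = 1 / p - 1"
      using p by (simp_all add: q_def field_simps)
    ultimately show ?thesis by simp
  qed
  moreover have "0 < real s * q ^ s" using s q by simp
  moreover have "0 \<le> real s * q ^ (2 * s) / (1 - q ^ s)" using q by (simp add: power_le_one)
  ultimately show ?thesis using p by (simp add: hub_cost_0 add_divide_distrib flip: q_def)
qed

lemma ex_power_small:
  fixes q :: real
  assumes "0 < q" "q < 1"
  shows "\<exists>s::nat. 0 < s \<and> (2 * real s ^ 2 + 1) * q ^ s < 1"
proof -
  have "(\<lambda>s::nat. (2 * real s ^ 2 + 1) * q ^ s) \<longlonglongrightarrow> 0"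
    using assms by real_asymp
  then have "eventually (\<lambda>s::nat. (2 * real s ^ 2 + 1) * q ^ s < 1) sequentially"
    by (rule order_tendstoD) simp
  then show ?thesis
    using eventually_happens'[OF sequentially_bot eventually_conj[OF eventually_gt_at_top[of 0]]]
    by simp
qed

theorem theorem2:
  fixes p :: real
  assumes "0 < p" and "p < 1"
  defines "q \<equiv> 1 - p"
  defines "s \<equiv> (LEAST s::nat. 0 < s \<and> (2 * real s ^ 2 + 1) * q ^ s < 1)"
  defines "c \<equiv> (if p > 1 - 1 / root 3 7
                 then 3 * (1 + q ^ 3) / (2 * (1 - q ^ 3))
                 else (real s + 1) / 2 + real s * q ^ s + real s * q ^ (2 * s) / (1 - q ^ s))"
  shows "\<exists>\<epsilon> :: nat \<Rightarrow> real. \<epsilon> \<longlonglongrightarrow> 0 \<and>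
           (\<lambda>n. measure_pmf.prob (Gnp n p)
                  {G. real (sat_C4 G) \<le> c * real n * (1 + \<epsilon> n)}) \<longlonglongrightarrow> 1"
proof -
  have "hub_cost p 0 < c"
  proof (cases "p > 1 - 1 / root 3 7")
    case True
    then show ?thesis using hub_cost_0_less_dense_constant[OF assms(1,2)] by (simp add: c_def q_def)
  next
    case False
    then have "(1 / root 3 7) ^ 3 \<le> q ^ 3" by (intro power_mono) (auto simp: q_def)
    then have "1 / 7 \<le> q ^ 3" by (simp add: power_divide)
    moreover have "0 < s \<and> (2 * real s ^ 2 + 1) * q ^ s < 1"
      unfolding s_def by (rule LeastI_ex) (use assms ex_power_small in \<open>auto simp: q_def\<close>)
    ultimately have "hub_cost p 0
        < (real s + 1) / 2 + real s * q ^ s + real s * q ^ (2 * s) / (1 - q ^ s)"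
      using hub_cost_0_less_sparse_constant[OF assms(1,2)] by (simp add: q_def)
    with False show ?thesis by (simp add: c_def)
  qed
  then have "(\<lambda>n. measure_pmf.prob (Gnp n p) {G. real (sat_C4 G) \<le> c * real n}) \<longlonglongrightarrow> 1"
    using assms(1,2) by (intro Gnp_sat_C4_le_tendsto_1) auto
  then show ?thesis by (intro exI[of _ "\<lambda>_. 0"]) simp
qed

end
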